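(* Let $\{(p_h^m,\mu_h^m,\varphi_h^m)\}_{m=1}^M$ be the unique solution of the fully discrete scheme described in the context, with initial value $\varphi_h^0=\varphi_{0h}\in V_h$, and define $\mathbf u_h^m:=-\nabla p_h^m-\gamma\varphi_h^{m-1}\nabla\mu_h^m$ and $E_h^m:=\mathcal J_\varepsilon(\varphi_h^m)$. Then for all $0\le \ell\le M$, $$E_h^\ell+\tau\sum_{m=1}^\ell\Big\{\varepsilon\|\nabla\mu_h^m\|_{L^2}^2+\frac1\gamma\|\mathbf u_h^m\|_{L^2}^2+\frac{\tau}{4\varepsilon}\Big[2\varepsilon^2\|d_t\nabla\varphi_h^m\|_{L^2}^2+\|d_t(\varphi_h^m)^2\|_{L^2}^2+2\|\varphi_h^m d_t\varphi_h^m\|_{L^2}^2+2\|d_t\varphi_h^m\|_{L^2}^2\Big]\Big\}=E_h^0 .$$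
   Context: Let $d\in\{2,3\}$, let $\Omega\subset\mathbb{R}^d$ be a bounded polygonal ($d=2$) or polyhedral ($d=3$) domain, and let $\gamma>0$, $T>0$, $0<\varepsilon<1$. Let $M\ge1$ be an integer, $\tau:=T/M$, $t_m:=m\tau$, and $d_tv^m:=(v^m-v^{m-1})/\tau$ for any sequence $\{v^m\}$. Let $\mathcal T_h$ be a quasi-uniform triangulation of $\Omega$ (triangles or tetrahedra) of mesh size $h\in(0,1)$. Let $S_h^r:=\{v_h\in C^0(\overline\Omega): v_h|_K\in P_r(K)\ \forall K\in\mathcal T_h\}$, where $P_r(K)$ is the space of polynomials of degree at most $r$ on $K$; for two fixed positive integers $r,r'$ set $V_h:=S_h^r$, $W_h:=S_h^{r'}$, and $\mathring W_h:=W_h\cap L^2_0(\Omega)$, where $L_0^2(\Omega)$ is the space of $L^2(\Omega)$ functions with zero mean. $(\cdot,\cdot)$ is the $L^2(\Omega)$ inner product. Energy: $F(\varphi)=\frac14(\varphi^2-1)^2$ and $\mathcal J_\varepsilon(\varphi):=\int_\Omega\big[\frac\varepsilon2|\nabla\varphi|^2+\frac1\varepsilon F(\varphi)\big]dx$. Fully discrete scheme: given $\varphi_h^0=\varphi_{0h}\in V_h$, find $\{(p_h^m,\mu_h^m,\varphi_h^m)\}_{m=1}^M\subset\mathring W_h\times V_h\times V_h$ such that for each $m$ $(\nabla p_h^m+\gamma\varphi_h^{m-1}\nabla\mu_h^m,\nabla q_h)=0$ for all $q_h\in W_h$; $(d_t\varphi_h^m,\nu_h)+\varepsilon(\nabla\mu_h^m,\nabla\nu_h)+(\varphi_h^{m-1}[\nabla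 p_h^m+\gamma\varphi_h^{m-1}\nabla\mu_h^m],\nabla\nu_h)=0$ for all $\nu_h\in V_h$; $(\mu_h^m,\psi_h)-\varepsilon(\nabla\varphi_h^m,\nabla\psi_h)-\frac1\varepsilon(f_h^m,\psi_h)=0$ for all $\psi_h\in V_h$, where $f_h^m:=(\varphi_h^m)^3-\varphi_h^{m-1}$. (This scheme has a unique solution.) *)

theory Defs
  imports "HOL-Analysis.Analysis"
begin

section \<open>Domains and meshes\<close>

text \<open>The boundary of a polyhedral domain consists of finitely many convex polytopes of dimension
  \<open>d - 1\<close>: line segments for \<open>d = 2\<close>, flat convex polygons for \<open>d = 3\<close>.\<close>

definition bounded_polyhedral_domain :: "(real^'d) set \<Rightarrow> bool" where
  "bounded_polyhedral_domain \<Omega> \<longleftrightarrow>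
     open \<Omega> \<and> connected \<Omega> \<and> \<Omega> \<noteq> {} \<and> bounded \<Omega> \<and>
     (\<exists>\<F>. finite \<F> \<and> (\<forall>S\<in>\<F>. polytope S \<and> aff_dim S = int CARD('d) - 1) \<and> frontier \<Omega> = \<Union>\<F>)"

text \<open>The library's \<^const>\<open>triangulation\<close> supplies finiteness and conformity (two cells meet in a
  common, possibly empty, face), but it allows cells of any dimension; here all cells are
  \<open>d\<close>-simplices.\<close>

definition triangulation_of :: "(real^'d) set \<Rightarrow> (real^'d) set set \<Rightarrow> bool" where
  "triangulation_of \<Omega> \<T> \<longleftrightarrow>
     triangulation \<T> \<and> (\<forall>K\<in>\<T>. int CARD('d) simplex K) \<and> \<Union>\<T> = closure \<Omega>"

definition mesh_size :: "(real^'d) set set \<Rightarrow> real" where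
  "mesh_size \<T> = Max (diameter ` \<T>)"

text \<open>Quasi-uniformity is a condition on a family of meshes: there is one constant \<open>\<sigma> > 0\<close> such that
  each cell of each mesh contains a ball of diameter \<open>\<sigma>\<close> times the mesh size. Here the constant
  appears as a parameter, so that the condition applies to a single member of the family.\<close>

definition quasi_uniform :: "real \<Rightarrow> (real^'d) set set \<Rightarrow> bool" where
  "quasi_uniform \<sigma> \<T> \<longleftrightarrow> (\<forall>K\<in>\<T>. \<exists>x. cball x (\<sigma> * mesh_size \<T> / 2) \<subseteq> K)"

section \<open>Finite element spaces\<close>

definition multi_indices :: "nat \<Rightarrow> ('d::finite \<Rightarrow> nat) set" where
  "multi_indices r = {\<alpha>. (\<Sum>i\<in>UNIV. \<alpha> i) \<le> r}"

lemma finite_multi_indices: "finite (multi_indices r :: ('d::finite \<Rightarrow> nat) set)"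
proof (rule finite_subset)
  show "(multi_indices r :: ('d \<Rightarrow> nat) set) \<subseteq> (\<Pi>\<^sub>E i\<in>UNIV. {..r})"
  proof
    fix \<alpha> :: "'d \<Rightarrow> nat" assume "\<alpha> \<in> multi_indices r"
    then have le: "(\<Sum>i\<in>UNIV. \<alpha> i) \<le> r" by (simp add: multi_indices_def)
    have "\<alpha> i \<le> (\<Sum>i\<in>UNIV. \<alpha> i)" for i by (rule member_le_sum) auto
    with le have "\<alpha> i \<le> r" for i using order_trans by blast
    then show "\<alpha> \<in> (\<Pi>\<^sub>E i\<in>UNIV. {..r})" by (simp add: PiE_def Pi_def)
  qed
  show "finite (\<Pi>\<^sub>E i\<in>(UNIV::'d set). {..r})" by (rule finite_PiE) auto
qed

definition polynomials_upto :: "nat \<Rightarrow> (real^'d \<Rightarrow> real) set" where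
  "polynomials_upto r =
     {q. \<exists>c. \<forall>x. q x = (\<Sum>\<alpha>\<in>multi_indices r. c \<alpha> * (\<Prod>i\<in>UNIV. (x $ i) ^ \<alpha> i))}"

text \<open>Elements are total functions, of which only the values on \<open>closure \<Omega>\<close> are relevant;
  no integral over \<open>\<Omega>\<close> below depends on their values elsewhere.\<close>

definition fe_space :: "nat \<Rightarrow> (real^'d) set \<Rightarrow> (real^'d) set set \<Rightarrow> (real^'d \<Rightarrow> real) set" where
  "fe_space r \<Omega> \<T> =
     {v. continuous_on (closure \<Omega>) v \<and> (\<forall>K\<in>\<T>. \<exists>q\<in>polynomials_upto r. \<forall>x\<in>K. v x = q x)}"

definition mean_zero_L2 :: "(real^'d) set \<Rightarrow> (real^'d \<Rightarrow> real) set" where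
  "mean_zero_L2 \<Omega> =
     {v \<in> borel_measurable (lebesgue_on \<Omega>).
        integrable (lebesgue_on \<Omega>) (\<lambda>x. (v x)\<^sup>2) \<and> (LINT x|lebesgue_on \<Omega>. v x) = 0}"

definition L2_inner :: "(real^'d) set \<Rightarrow> (real^'d \<Rightarrow> 'b::real_inner) \<Rightarrow> (real^'d \<Rightarrow> 'b) \<Rightarrow> real" where
  "L2_inner \<Omega> u v = (LINT x|lebesgue_on \<Omega>. u x \<bullet> v x)"

definition L2_norm :: "(real^'d) set \<Rightarrow> (real^'d \<Rightarrow> 'b::real_inner) \<Rightarrow> real" where
  "L2_norm \<Omega> u = sqrt (L2_inner \<Omega> u u)"

text \<open>A finite element function is differentiable in the interior of every cell, hence almost
  everywhere in \<open>\<Omega>\<close>. Its pointwise gradient is almost everywhere equal to its weak gradient;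
  the arbitrary value on the null set of points of non-differentiability does not affect any integral.\<close>

definition grad :: "(real^'d \<Rightarrow> real) \<Rightarrow> real^'d \<Rightarrow> real^'d" where
  "grad v x = (THE D. GDERIV v x :> D)"

section \<open>Energy and fully discrete scheme\<close>

definition double_well :: "real \<Rightarrow> real" where
  "double_well s = 1/4 * (s\<^sup>2 - 1)\<^sup>2"

definition energy :: "real \<Rightarrow> (real^'d) set \<Rightarrow> (real^'d \<Rightarrow> real) \<Rightarrow> real" where
  "energy \<epsilon> \<Omega> \<phi> =
     (LINT x|lebesgue_on \<Omega>. \<epsilon>/2 * (norm (grad \<phi> x))\<^sup>2 + 1/\<epsilon> * double_well (\<phi> x))"

definition d\<^sub>t :: "real \<Rightarrow> (nat \<Rightarrow> 'a \<Rightarrow> 'b::real_vector) \<Rightarrow> nat \<Rightarrow> 'a \<Rightarrow> 'b" where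
  "d\<^sub>t \<tau> v m = (\<lambda>x. (v m x - v (m - 1) x) /\<^sub>R \<tau>)"

definition velocity ::
    "real \<Rightarrow> (nat \<Rightarrow> real^'d \<Rightarrow> real) \<Rightarrow> (nat \<Rightarrow> real^'d \<Rightarrow> real) \<Rightarrow> (nat \<Rightarrow> real^'d \<Rightarrow> real) \<Rightarrow>
     nat \<Rightarrow> real^'d \<Rightarrow> real^'d" where
  "velocity \<gamma> p \<mu> \<phi> m = (\<lambda>x. - grad (p m) x - (\<gamma> * \<phi> (m - 1) x) *\<^sub>R grad (\<mu> m) x)"

definition fully_discrete_solution ::
    "real \<Rightarrow> real \<Rightarrow> real \<Rightarrow> nat \<Rightarrow> (real^'d) set \<Rightarrow> (real^'d \<Rightarrow> real) set \<Rightarrow> (real^'d \<Rightarrow> real) set \<Rightarrow>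
     (real^'d \<Rightarrow> real) \<Rightarrow>
     (nat \<Rightarrow> real^'d \<Rightarrow> real) \<Rightarrow> (nat \<Rightarrow> real^'d \<Rightarrow> real) \<Rightarrow> (nat \<Rightarrow> real^'d \<Rightarrow> real) \<Rightarrow> bool" where
  "fully_discrete_solution \<epsilon> \<gamma> \<tau> M \<Omega> V W \<phi>\<^sub>0 p \<mu> \<phi> \<longleftrightarrow>
     \<phi> 0 = \<phi>\<^sub>0 \<and>
     (\<forall>m\<in>{1..M}.
        p m \<in> W \<inter> mean_zero_L2 \<Omega> \<and> \<mu> m \<in> V \<and> \<phi> m \<in> V \<and>
        (\<forall>q\<in>W.
           L2_inner \<Omega> (\<lambda>x. grad (p m) x + (\<gamma> * \<phi> (m - 1) x) *\<^sub>R grad (\<mu> m) x) (grad q) = 0) \<and>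
        (\<forall>\<nu>\<in>V.
           L2_inner \<Omega> (d\<^sub>t \<tau> \<phi> m) \<nu> + \<epsilon> * L2_inner \<Omega> (grad (\<mu> m)) (grad \<nu>)
             + L2_inner \<Omega>
                 (\<lambda>x. \<phi> (m - 1) x *\<^sub>R (grad (p m) x + (\<gamma> * \<phi> (m - 1) x) *\<^sub>R grad (\<mu> m) x))
                 (grad \<nu>) = 0) \<and>
        (\<forall>\<psi>\<in>V.
           L2_inner \<Omega> (\<mu> m) \<psi> - \<epsilon> * L2_inner \<Omega> (grad (\<phi> m)) (grad \<psi>)
             - 1/\<epsilon> * L2_inner \<Omega> (\<lambda>x. (\<phi> m x)^3 - \<phi> (m - 1) x) \<psi> = 0))"

end

theory Submission
  imports Defs
begin

text \<open>In one time step, test the pressure equation with the pressure itself, the phase equation with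
  the chemical potential \<open>\<mu>\<close>, and the potential equation with \<open>d\<^sub>t \<phi>\<close>. The first test makes the
  velocity orthogonal to the pressure gradient, so the convective term of the second is
  exactly \<open>1/\<gamma>\<close> times the squared norm of the velocity (\<open>velocity_dissipation\<close>). The second and the
  third test share the pairing of \<open>\<mu>\<close> with \<open>d\<^sub>t \<phi>\<close>; eliminating it equates the dissipation with minus
  what the gradient term and the double-well term contribute when tested with \<open>d\<^sub>t \<phi>\<close>. That
  contribution is the discrete time derivative of the energy plus a sum of squares
  (\<open>energy_increment\<close>), by two algebraic identities that hold at each point: the polarization
  identity for the gradients and \<open>double_well_increment\<close> for the potential. This gives
  \<open>one_step_energy_balance\<close>, and the energy law follows by summing over the time steps.

  The analytic content lies in the gradients. The pointwise gradient of a finite element function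
  exists in the interior of each cell, hence almost everywhere, because the frontiers of finitely
  many convex cells form a null set. It is measurable and essentially bounded, and so are the
  functions themselves; on the bounded domain every product of such functions is therefore
  integrable, and integrals may be split term by term. Also almost everywhere, the gradient
  commutes with \<open>d\<^sub>t\<close>.\<close>

section \<open>Essentially bounded functions\<close>

text \<open>Measurability is part of the notion, so that an essentially bounded function on a space of
  finite measure is integrable. The functions with this property are closed under sums and
  products, which settles the integrability of every integrand of the scheme and of the
  energy.\<close>

definition ess_bounded :: "'a measure \<Rightarrow> ('a \<Rightarrow> 'b::euclidean_space) \<Rightarrow> bool" where
  "ess_bounded M f \<longleftrightarrow> f \<in> borel_measurable M \<and> (\<exists>B. AE x in M. norm (f x) \<le> B)"

lemma ess_bounded_const: "ess_bounded M (\<lambda>x. c)"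
  unfolding ess_bounded_def by auto

lemma ess_bounded_minus: "ess_bounded M f \<Longrightarrow> ess_bounded M (\<lambda>x. - f x)"
  unfolding ess_bounded_def by auto

lemma ess_bounded_add:
  assumes "ess_bounded M f" "ess_bounded M g"
  shows "ess_bounded M (\<lambda>x. f x + g x)"
proof -
  obtain B C where BC: "AE x in M. norm (f x) \<le> B" "AE x in M. norm (g x) \<le> C"
    and [measurable]: "f \<in> borel_measurable M" "g \<in> borel_measurable M"
    using assms unfolding ess_bounded_def by blast
  from BC have "AE x in M. norm (f x + g x) \<le> B + C"
    by eventually_elim (rule norm_add_rule_thm)
  then show ?thesis unfolding ess_bounded_def by auto
qed

lemma ess_bounded_diff:
  "ess_bounded M f \<Longrightarrow> ess_bounded M g \<Longrightarrow> ess_bounded M (\<lambda>x. f x - g x)"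
  using ess_bounded_add[of M f "\<lambda>x. - g x"] ess_bounded_minus[of M g] by simp

lemma ess_bounded_scaleR:
  assumes "ess_bounded M f" "ess_bounded M g"
  shows "ess_bounded M (\<lambda>x. f x *\<^sub>R g x)"
proof -
  obtain B C where BC: "AE x in M. norm (f x) \<le> B" "AE x in M. norm (g x) \<le> C"
    and [measurable]: "f \<in> borel_measurable M" "g \<in> borel_measurable M"
    using assms unfolding ess_bounded_def by blast
  from BC have "AE x in M. norm (f x *\<^sub>R g x) \<le> B * C"
    by eventually_elim (simp add: mult_mono')
  then show ?thesis unfolding ess_bounded_def by auto
qed

lemma ess_bounded_inner:
  assumes "ess_bounded M f" "ess_bounded M g"
  shows "ess_bounded M (\<lambda>x. f x \<bullet> g x)"
proof -
  obtain B C where BC: "AE x in M. norm (f x) \<le> B" "AE x in M. norm (g x) \<le> C"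
    and [measurable]: "f \<in> borel_measurable M" "g \<in> borel_measurable M"
    using assms unfolding ess_bounded_def by blast
  from BC have "AE x in M. norm (f x \<bullet> g x) \<le> B * C"
    by eventually_elim
      (metis Cauchy_Schwarz_ineq2 real_norm_def mult_mono norm_ge_zero order_trans)
  then show ?thesis unfolding ess_bounded_def by auto
qed

lemma ess_bounded_mult:
  fixes f g :: "'a \<Rightarrow> real"
  shows "ess_bounded M f \<Longrightarrow> ess_bounded M g \<Longrightarrow> ess_bounded M (\<lambda>x. f x * g x)"
  using ess_bounded_scaleR[of M f g] by simp

lemma ess_bounded_power:
  fixes f :: "'a \<Rightarrow> real"
  shows "ess_bounded M f \<Longrightarrow> ess_bounded M (\<lambda>x. f x ^ n)"
  by (induction n) (auto intro: ess_bounded_const ess_bounded_mult)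

lemmas ess_bounded_intros =
  ess_bounded_const ess_bounded_minus ess_bounded_add ess_bounded_diff ess_bounded_scaleR
  ess_bounded_inner ess_bounded_mult ess_bounded_power

lemma ess_bounded_integrable:
  "finite_measure M \<Longrightarrow> ess_bounded M f \<Longrightarrow> integrable M f"
  unfolding ess_bounded_def by (auto intro: finite_measure.integrable_const_bound)

section \<open>Gradients of polynomials\<close>

text \<open>Induction over the library's generation of polynomial functions from linear forms avoids
  differentiating monomials in several variables explicitly.\<close>

lemma real_polynomial_function_GDERIV:
  fixes q :: "'a::euclidean_space \<Rightarrow> real"
  assumes "real_polynomial_function q"
  shows "\<exists>D. continuous_on UNIV D \<and> (\<forall>x. GDERIV q x :> D x)"
  using assms
proof (induction rule: real_polynomial_function.induct)
  case (linear f)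
  then interpret bounded_linear f .
  have "f h = h \<bullet> adjoint f 1" for h
    using adjoint_works[OF linear_axioms, of h 1] by simp
  then have "GDERIV f x :> adjoint f 1" for x
    unfolding gderiv_def using bounded_linear_imp_has_derivative[OF linear.hyps] by (metis (no_types, lifting) ext)
  then show ?case by (intro exI[of _ "\<lambda>_. adjoint f 1"]) auto
next
  case (const c)
  then show ?case by (intro exI[of _ "\<lambda>_. 0"]) (auto intro: GDERIV_const)
next
  case (add f g)
  then obtain D E where "continuous_on UNIV D" "\<forall>x. GDERIV f x :> D x"
    "continuous_on UNIV E" "\<forall>x. GDERIV g x :> E x" by blast
  then show ?case
    by (intro exI[of _ "\<lambda>x. D x + E x"]) (auto intro: GDERIV_add continuous_intros)
next
  case (mult f g)
  then obtain D E where "continuous_on UNIV D" "\<forall>x. GDERIV f x :> D x"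
    "continuous_on UNIV E" "\<forall>x. GDERIV g x :> E x" by blast
  moreover have "continuous_on UNIV f" "continuous_on UNIV g"
    using mult.hyps by (auto intro: continuous_on_polymonial_function
      simp: real_polynomial_function_eq)
  ultimately show ?case
    by (intro exI[of _ "\<lambda>x. f x *\<^sub>R E x + g x *\<^sub>R D x"])
      (auto intro: GDERIV_mult continuous_intros)
qed

lemma polynomials_upto_real_polynomial_function:
  assumes "q \<in> polynomials_upto r"
  shows "real_polynomial_function q"
proof -
  obtain c where q: "\<And>x. q x = (\<Sum>\<alpha>\<in>multi_indices r. c \<alpha> * (\<Prod>i\<in>UNIV. (x $ i) ^ \<alpha> i))"
    using assms unfolding polynomials_upto_def by blast
  have "real_polynomial_function (\<lambda>x::real^'a. (x $ i) ^ n)" for i n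
    by (intro real_polynomial_function_power real_polynomial_function.intros(1) bounded_linear_vec_nth)
  then have "real_polynomial_function
      (\<lambda>x. \<Sum>\<alpha>\<in>multi_indices r. c \<alpha> * (\<Prod>i\<in>UNIV. (x $ i) ^ \<alpha> i))"
    by (intro real_polynomial_function_sum finite_multi_indices real_polynomial_function_prod
        real_polynomial_function.intros(2) real_polynomial_function.intros(4)) auto
  then show ?thesis by (simp add: q[abs_def])
qed

lemma polynomials_upto_linear_combination:
  assumes "p \<in> polynomials_upto r" "q \<in> polynomials_upto r"
  shows "(\<lambda>x. a * p x + b * q x) \<in> polynomials_upto r"
proof -
  obtain c d where "\<And>x. p x = (\<Sum>\<alpha>\<in>multi_indices r. c \<alpha> * (\<Prod>i\<in>UNIV. (x $ i) ^ \<alpha> i))"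
    and "\<And>x. q x = (\<Sum>\<alpha>\<in>multi_indices r. d \<alpha> * (\<Prod>i\<in>UNIV. (x $ i) ^ \<alpha> i))"
    using assms unfolding polynomials_upto_def by blast
  then show ?thesis
    unfolding polynomials_upto_def
    by (auto intro!: exI[of _ "\<lambda>\<alpha>. a * c \<alpha> + b * d \<alpha>"]
        simp: sum_distrib_left sum.distrib algebra_simps)
qed

section \<open>Gradients of finite element functions\<close>

lemma GDERIV_unique:
  assumes "GDERIV v x :> D" "GDERIV v x :> E"
  shows "D = E"
  using has_derivative_unique[OF assms[unfolded gderiv_def]]
  by (metis inner_commute vector_eq_rdot)

lemma grad_eqI: "GDERIV v x :> D \<Longrightarrow> grad v x = D"
  unfolding grad_def by (blast intro: GDERIV_unique)

text \<open>Inside a cell a finite element function coincides with a polynomial near each point, so it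
  inherits the continuous gradient of that polynomial.\<close>

lemma fe_space_gradient_on_cell:
  assumes v: "v \<in> fe_space r \<Omega> \<T>" and K: "K \<in> \<T>"
  obtains D where "continuous_on UNIV D"
    and "\<And>x. x \<in> interior K \<Longrightarrow> GDERIV v x :> grad v x \<and> grad v x = D x"
proof -
  obtain q where q: "q \<in> polynomials_upto r" "\<And>x. x \<in> K \<Longrightarrow> v x = q x"
    using assms unfolding fe_space_def by blast
  obtain D where D: "continuous_on UNIV D" "\<And>x. GDERIV q x :> D x"
    using real_polynomial_function_GDERIV[OF polynomials_upto_real_polynomial_function[OF q(1)]]
    by blast
  have "GDERIV v x :> D x" if x: "x \<in> interior K" for x
    unfolding gderiv_def
    by (rule has_derivative_transform_within_open[OF D(2)[unfolded gderiv_def] open_interior x])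
      (use q(2) interior_subset in force)
  then show ?thesis using that[OF D(1)] grad_eqI by metis
qed

locale polyhedral_mesh =
  fixes \<Omega> :: "(real^'d) set" and \<T> :: "(real^'d) set set"
  assumes domain: "bounded_polyhedral_domain \<Omega>"
    and mesh: "triangulation_of \<Omega> \<T>"
begin

lemma open_domain: "open \<Omega>" and bounded_domain: "bounded \<Omega>"
  using domain unfolding bounded_polyhedral_domain_def by auto

lemma finite_mesh: "finite \<T>" and convex_cell: "K \<in> \<T> \<Longrightarrow> convex K"
  and compact_cell: "K \<in> \<T> \<Longrightarrow> compact K" and cells_cover: "\<Union>\<T> = closure \<Omega>"
  using mesh unfolding triangulation_of_def triangulation_def
  by (auto intro: convex_simplex compact_simplex)

lemma lebesgue_domain [measurable]: "\<Omega> \<in> sets lebesgue"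
  by (intro sets_completionI_sets lborelD borel_open open_domain)

lemma finite_measure_domain: "finite_measure (lebesgue_on \<Omega>)"
  using bounded_set_imp_lmeasurable[OF bounded_domain lebesgue_domain]
  by (simp add: finite_measure_lebesgue_on)

text \<open>Cells are convex, so their finitely many frontiers form a null set.\<close>

lemma negligible_skeleton: "negligible (\<Omega> - \<Union> (interior ` \<T>))"
proof (rule negligible_subset)
  show "negligible (\<Union> (frontier ` \<T>))"
    using finite_mesh convex_cell by (auto intro!: negligible_Union negligible_convex_frontier)
  show "\<Omega> - \<Union> (interior ` \<T>) \<subseteq> \<Union> (frontier ` \<T>)"
  proof
    fix x assume x: "x \<in> \<Omega> - \<Union> (interior ` \<T>)"
    then obtain K where "K \<in> \<T>" "x \<in> K" using cells_cover closure_subset by blast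
    with x show "x \<in> \<Union> (frontier ` \<T>)"
      unfolding frontier_def using closure_subset by fastforce
  qed
qed

lemma AE_cell_interior:
  assumes "\<And>K x. K \<in> \<T> \<Longrightarrow> x \<in> interior K \<Longrightarrow> x \<in> \<Omega> \<Longrightarrow> P x"
  shows "AE x in lebesgue_on \<Omega>. P x"
proof -
  have "AE x in lebesgue. x \<notin> \<Omega> - \<Union> (interior ` \<T>)"
    using negligible_skeleton by (intro AE_not_in) (simp add: negligible_iff_null_sets)
  then have "AE x in lebesgue. x \<in> \<Omega> \<longrightarrow> P x"
    by eventually_elim (use assms in blast)
  then show ?thesis by (simp add: AE_restrict_space_iff)
qed

text \<open>Linearity of the space makes \<open>d\<^sub>t \<phi>\<close> an admissible test function.\<close>

lemma fe_space_linear_combination: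
  assumes "v \<in> fe_space r \<Omega> \<T>" "w \<in> fe_space r \<Omega> \<T>"
  shows "(\<lambda>x. a * v x + b * w x) \<in> fe_space r \<Omega> \<T>"
proof -
  have "\<exists>q\<in>polynomials_upto r. \<forall>x\<in>K. a * v x + b * w x = q x" if K: "K \<in> \<T>" for K
  proof -
    obtain p q where "p \<in> polynomials_upto r" "\<forall>x\<in>K. v x = p x"
      "q \<in> polynomials_upto r" "\<forall>x\<in>K. w x = q x"
      using assms K unfolding fe_space_def by blast
    then show ?thesis
      using polynomials_upto_linear_combination by (intro bexI[of _ "\<lambda>x. a * p x + b * q x"]) auto
  qed
  moreover have "continuous_on (closure \<Omega>) (\<lambda>x. a * v x + b * w x)"
    using assms unfolding fe_space_def by (auto intro!: continuous_intros)
  ultimately show ?thesis unfolding fe_space_def by blast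
qed

lemma d\<^sub>t_fe_space:
  fixes \<phi> :: "nat \<Rightarrow> real^'d \<Rightarrow> real"
  assumes "\<phi> m \<in> fe_space r \<Omega> \<T>" "\<phi> (m - 1) \<in> fe_space r \<Omega> \<T>"
  shows "d\<^sub>t \<tau> \<phi> m \<in> fe_space r \<Omega> \<T>"
  using fe_space_linear_combination[OF assms, of "1/\<tau>" "-1/\<tau>"]
  by (simp add: d\<^sub>t_def divide_inverse algebra_simps)

lemma ess_bounded_fe_space:
  assumes "v \<in> fe_space r \<Omega> \<T>"
  shows "ess_bounded (lebesgue_on \<Omega>) v"
proof -
  have cont: "continuous_on (closure \<Omega>) v" using assms unfolding fe_space_def by blast
  have "bounded (v ` closure \<Omega>)"
    using bounded_domain by (intro compact_imp_bounded compact_continuous_image cont) auto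
  then obtain B where "\<And>x. x \<in> closure \<Omega> \<Longrightarrow> norm (v x) \<le> B"
    unfolding bounded_iff by blast
  then have "AE x in lebesgue_on \<Omega>. norm (v x) \<le> B"
    using closure_subset by (intro AE_I2) auto
  moreover have "v \<in> borel_measurable (lebesgue_on \<Omega>)"
    using continuous_on_subset[OF cont closure_subset] lebesgue_domain
    by (rule continuous_imp_measurable_on_sets_lebesgue)
  ultimately show ?thesis unfolding ess_bounded_def by blast
qed

text \<open>The gradient is continuous on the union of the open cells, and the values on the remaining
  null set do not influence measurability because Lebesgue measure is complete.\<close>

lemma measurable_grad_fe_space:
  assumes v: "v \<in> fe_space r \<Omega> \<T>"
  shows "grad v \<in> borel_measurable (lebesgue_on \<Omega>)"
proof (rule measurableI)
  let ?U = "\<Omega> \<inter> \<Union> (interior ` \<T>)"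
  have "continuous_on (interior K) (grad v)" if K: "K \<in> \<T>" for K
  proof -
    obtain D where "continuous_on UNIV D" "\<And>x. x \<in> interior K \<Longrightarrow> grad v x = D x"
      using fe_space_gradient_on_cell[OF v K] by metis
    then show ?thesis
      using continuous_on_cong continuous_on_subset by (metis subset_UNIV)
  qed
  then have "continuous_on (\<Union> (interior ` \<T>)) (grad v)"
    by (intro continuous_on_open_Union) auto
  then have cont: "continuous_on ?U (grad v)" by (rule continuous_on_subset) auto
  have U: "?U \<in> sets lebesgue"
    by (intro sets_completionI_sets lborelD borel_open open_Int open_domain open_Union) auto
  fix B :: "(real^'d) set" assume B: "B \<in> sets borel"
  have "grad v -` B \<inter> ?U \<in> sets lebesgue"
    using measurable_sets[OF continuous_imp_measurable_on_sets_lebesgue[OF cont U] B] U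
    by (simp add: sets_restrict_space_iff)
  moreover have "grad v -` B \<inter> (\<Omega> - \<Union> (interior ` \<T>)) \<in> sets lebesgue"
    by (rule negligible_imp_sets, rule negligible_subset[OF negligible_skeleton]) blast
  moreover have "grad v -` B \<inter> \<Omega> =
      (grad v -` B \<inter> ?U) \<union> (grad v -` B \<inter> (\<Omega> - \<Union> (interior ` \<T>)))" by blast
  ultimately have "grad v -` B \<inter> \<Omega> \<in> sets lebesgue" by (metis sets.Un)
  then show "grad v -` B \<inter> space (lebesgue_on \<Omega>) \<in> sets (lebesgue_on \<Omega>)"
    by (simp add: sets_restrict_space_iff)
qed simp

lemma ess_bounded_grad_fe_space:
  assumes v: "v \<in> fe_space r \<Omega> \<T>"
  shows "ess_bounded (lebesgue_on \<Omega>) (grad v)"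
proof -
  have "\<exists>B. \<forall>x\<in>interior K. norm (grad v x) \<le> B" if K: "K \<in> \<T>" for K
  proof -
    obtain D where D: "continuous_on UNIV D" "\<And>x. x \<in> interior K \<Longrightarrow> grad v x = D x"
      using fe_space_gradient_on_cell[OF v K] by metis
    have "bounded (D ` K)"
      using compact_cell[OF K] continuous_on_subset[OF D(1)]
      by (intro compact_imp_bounded compact_continuous_image) auto
    then obtain B where "\<forall>x\<in>K. norm (D x) \<le> B" unfolding bounded_iff by blast
    then show ?thesis using D(2) interior_subset by (metis subsetD)
  qed
  then obtain B where B: "\<And>K x. K \<in> \<T> \<Longrightarrow> x \<in> interior K \<Longrightarrow> norm (grad v x) \<le> B K" by metis
  have "AE x in lebesgue_on \<Omega>. norm (grad v x) \<le> Max (B ` \<T>)"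
    by (rule AE_cell_interior) (meson B Max_ge finite_imageI finite_mesh imageI order_trans)
  then show ?thesis using measurable_grad_fe_space[OF v] unfolding ess_bounded_def by blast
qed

lemma AE_grad_d\<^sub>t:
  fixes \<phi> :: "nat \<Rightarrow> real^'d \<Rightarrow> real"
  assumes "\<phi> m \<in> fe_space r \<Omega> \<T>" "\<phi> (m - 1) \<in> fe_space r \<Omega> \<T>"
  shows "AE x in lebesgue_on \<Omega>. grad (d\<^sub>t \<tau> \<phi> m) x = d\<^sub>t \<tau> (\<lambda>k. grad (\<phi> k)) m x"
proof (rule AE_cell_interior)
  fix K x assume K: "K \<in> \<T>" and x: "x \<in> interior K"
  have "GDERIV (\<phi> m) x :> grad (\<phi> m) x" "GDERIV (\<phi> (m - 1)) x :> grad (\<phi> (m - 1)) x"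
    using fe_space_gradient_on_cell[OF assms(1) K] fe_space_gradient_on_cell[OF assms(2) K] x
    by metis+
  from GDERIV_mult[OF GDERIV_const[of "inverse \<tau>"] GDERIV_diff[OF this]]
  show "grad (d\<^sub>t \<tau> \<phi> m) x = d\<^sub>t \<tau> (\<lambda>k. grad (\<phi> k)) m x"
    by (intro grad_eqI) (simp add: d\<^sub>t_def)
qed

section \<open>The energy balance of one time step\<close>

lemma L2_norm_squared: "(L2_norm A u)\<^sup>2 = (LINT x|lebesgue_on A. u x \<bullet> u x)"
  unfolding L2_norm_def L2_inner_def by simp

text \<open>The convex part \<open>a\<^sup>4/4\<close> of the potential is treated implicitly and its concave part
  \<open>- a\<^sup>2/2\<close> explicitly. With this splitting both parts leave a nonnegative remainder: the first two
  squares come from the convex part, the last one from the concave part.\<close>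

lemma double_well_increment:
  "(a ^ 3 - b) * (a - b) = double_well a - double_well b
     + 1/4 * ((a\<^sup>2 - b\<^sup>2)\<^sup>2 + 2 * (a * (a - b))\<^sup>2 + 2 * (a - b)\<^sup>2)"
  unfolding double_well_def by algebra

lemma half_norm_squared_increment:
  fixes a b :: "'a::real_inner"
  shows "2 * (a \<bullet> (a - b)) = (norm a)\<^sup>2 - (norm b)\<^sup>2 + (norm (a - b))\<^sup>2"
  by (simp add: power2_norm_eq_inner inner_diff inner_commute)

lemma energy_increment:
  fixes \<phi> :: "nat \<Rightarrow> real^'d \<Rightarrow> real" and \<epsilon> \<tau> :: real
  assumes fe: "\<phi> m \<in> fe_space r \<Omega> \<T>" "\<phi> (m - 1) \<in> fe_space r \<Omega> \<T>"
    and pos: "\<epsilon> > 0" "\<tau> > 0"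
  shows "\<tau> * (\<epsilon> * L2_inner \<Omega> (grad (\<phi> m)) (grad (d\<^sub>t \<tau> \<phi> m))
        + 1/\<epsilon> * L2_inner \<Omega> (\<lambda>x. (\<phi> m x)^3 - \<phi> (m - 1) x) (d\<^sub>t \<tau> \<phi> m))
    = energy \<epsilon> \<Omega> (\<phi> m) - energy \<epsilon> \<Omega> (\<phi> (m - 1))
      + \<tau> * (\<tau> / (4 * \<epsilon>) *
              (2 * \<epsilon>\<^sup>2 * (L2_norm \<Omega> (d\<^sub>t \<tau> (\<lambda>k. grad (\<phi> k)) m))\<^sup>2
               + (L2_norm \<Omega> (d\<^sub>t \<tau> (\<lambda>k x. (\<phi> k x)\<^sup>2) m))\<^sup>2
               + 2 * (L2_norm \<Omega> (\<lambda>x. \<phi> m x * d\<^sub>t \<tau> \<phi> m x))\<^sup>2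
               + 2 * (L2_norm \<Omega> (d\<^sub>t \<tau> \<phi> m))\<^sup>2))"
proof -
  let ?M = "lebesgue_on \<Omega>" and ?a = "\<phi> m" and ?b = "\<phi> (m - 1)"
  let ?A = "grad (\<phi> m)" and ?B = "grad (\<phi> (m - 1))"
  \<comment> \<open>\<open>DG\<close> and \<open>grad dp\<close> agree only almost everywhere: the energy law uses the former, the
    potential equation the latter.\<close>
  define DG where "DG = d\<^sub>t \<tau> (\<lambda>k. grad (\<phi> k)) m"
  define dp where "dp = d\<^sub>t \<tau> \<phi> m"
  define ds where "ds = d\<^sub>t \<tau> (\<lambda>k x. (\<phi> k x)\<^sup>2) m"
  note int = ess_bounded_integrable[OF finite_measure_domain]
  have eb: "ess_bounded ?M ?a" "ess_bounded ?M ?b" "ess_bounded ?M ?A" "ess_bounded ?M ?B"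
    "ess_bounded ?M dp" "ess_bounded ?M (grad dp)"
    using fe d\<^sub>t_fe_space[of \<phi>, OF fe] unfolding dp_def
    by (auto intro: ess_bounded_fe_space ess_bounded_grad_fe_space)
  have eb': "ess_bounded ?M DG" "ess_bounded ?M ds"
    unfolding DG_def ds_def d\<^sub>t_def by (intro ess_bounded_intros eb)+
  have gg: "integrable ?M (\<lambda>x. ?A x \<bullet> grad dp x)" "integrable ?M (\<lambda>x. ((?a x)^3 - ?b x) \<bullet> dp x)"
    "integrable ?M (\<lambda>x. DG x \<bullet> DG x)" "integrable ?M (\<lambda>x. ds x \<bullet> ds x)"
    "integrable ?M (\<lambda>x. (?a x * dp x) \<bullet> (?a x * dp x))" "integrable ?M (\<lambda>x. dp x \<bullet> dp x)"
    by (intro int ess_bounded_intros eb eb')+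
  have en: "integrable ?M (\<lambda>x. \<epsilon>/2 * (norm (?A x))\<^sup>2 + 1/\<epsilon> * double_well (?a x))"
    "integrable ?M (\<lambda>x. \<epsilon>/2 * (norm (?B x))\<^sup>2 + 1/\<epsilon> * double_well (?b x))"
    unfolding double_well_def power2_norm_eq_inner by (intro int ess_bounded_intros eb)+
  have ae: "AE x in ?M. \<tau> * (\<epsilon> * (?A x \<bullet> grad dp x) + 1/\<epsilon> * (((?a x)^3 - ?b x) \<bullet> dp x))
    = (\<epsilon>/2 * (norm (?A x))\<^sup>2 + 1/\<epsilon> * double_well (?a x))
      - (\<epsilon>/2 * (norm (?B x))\<^sup>2 + 1/\<epsilon> * double_well (?b x))
      + \<tau> * (\<tau> / (4 * \<epsilon>) * (2 * \<epsilon>\<^sup>2 * (DG x \<bullet> DG x) + ds x \<bullet> ds x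
          + 2 * ((?a x * dp x) \<bullet> (?a x * dp x)) + 2 * (dp x \<bullet> dp x)))"
    using AE_grad_d\<^sub>t[of \<phi>, OF fe, of \<tau>, folded dp_def DG_def]
  proof eventually_elim
    case (elim x)
    have scaled: "?A x - ?B x = \<tau> *\<^sub>R DG x" "?a x - ?b x = \<tau> * dp x" "(?a x)\<^sup>2 - (?b x)\<^sup>2 = \<tau> * ds x"
      using pos by (auto simp: DG_def dp_def ds_def d\<^sub>t_def)
    have "2 * \<tau> * (?A x \<bullet> DG x) = (norm (?A x))\<^sup>2 - (norm (?B x))\<^sup>2 + \<tau>\<^sup>2 * (DG x \<bullet> DG x)"
      using half_norm_squared_increment[of "?A x" "?B x"] unfolding scaled
      by (simp add: power_mult_distrib power2_norm_eq_inner mult.assoc)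
    moreover have "\<tau> * (((?a x)^3 - ?b x) * dp x) = double_well (?a x) - double_well (?b x)
        + \<tau>\<^sup>2/4 * (ds x * ds x + 2 * ((?a x * dp x) * (?a x * dp x)) + 2 * (dp x * dp x))"
      using double_well_increment[of "?a x" "?b x"] unfolding scaled
      by (simp add: power2_eq_square algebra_simps)
    moreover have "\<tau> * (\<epsilon> * (?A x \<bullet> DG x) + 1/\<epsilon> * (((?a x)^3 - ?b x) * dp x))
      = \<epsilon>/2 * (2 * \<tau> * (?A x \<bullet> DG x)) + 1/\<epsilon> * (\<tau> * (((?a x)^3 - ?b x) * dp x))"
      by (simp add: algebra_simps)
    ultimately have "\<tau> * (\<epsilon> * (?A x \<bullet> DG x) + 1/\<epsilon> * (((?a x)^3 - ?b x) * dp x))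
      = \<epsilon>/2 * ((norm (?A x))\<^sup>2 - (norm (?B x))\<^sup>2 + \<tau>\<^sup>2 * (DG x \<bullet> DG x))
        + 1/\<epsilon> * (double_well (?a x) - double_well (?b x)
        + \<tau>\<^sup>2/4 * (ds x * ds x + 2 * ((?a x * dp x) * (?a x * dp x)) + 2 * (dp x * dp x)))"
      by (simp only:)
    moreover have "\<tau> * (\<tau> / (4 * \<epsilon>) * (2 * \<epsilon>\<^sup>2 * D + R + S + T))
        = \<epsilon>/2 * (\<tau>\<^sup>2 * D) + 1/\<epsilon> * (\<tau>\<^sup>2/4 * (R + S + T))" for D R S T
      using pos(1) by (simp add: field_simps power2_eq_square)
    ultimately show ?case
      unfolding elim inner_real_def by (simp only: distrib_left right_diff_distrib)
  qed
  have "\<tau> * (\<epsilon> * L2_inner \<Omega> ?A (grad dp) + 1/\<epsilon> * L2_inner \<Omega> (\<lambda>x. (?a x)^3 - ?b x) dp)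
    = (LINT x|?M. \<tau> * (\<epsilon> * (?A x \<bullet> grad dp x) + 1/\<epsilon> * (((?a x)^3 - ?b x) \<bullet> dp x)))"
    unfolding L2_inner_def using gg by simp
  also have "\<dots> = (LINT x|?M. (\<epsilon>/2 * (norm (?A x))\<^sup>2 + 1/\<epsilon> * double_well (?a x))
      - (\<epsilon>/2 * (norm (?B x))\<^sup>2 + 1/\<epsilon> * double_well (?b x))
      + \<tau> * (\<tau> / (4 * \<epsilon>) * (2 * \<epsilon>\<^sup>2 * (DG x \<bullet> DG x) + ds x \<bullet> ds x
          + 2 * ((?a x * dp x) \<bullet> (?a x * dp x)) + 2 * (dp x \<bullet> dp x))))"
    by (rule integral_cong_AE) (use ae gg en in \<open>auto intro!: borel_measurable_integrable\<close>)
  also have "\<dots> = energy \<epsilon> \<Omega> ?a - energy \<epsilon> \<Omega> ?b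
      + \<tau> * (\<tau> / (4 * \<epsilon>) * (2 * \<epsilon>\<^sup>2 * (L2_norm \<Omega> DG)\<^sup>2 + (L2_norm \<Omega> ds)\<^sup>2
          + 2 * (L2_norm \<Omega> (\<lambda>x. ?a x * dp x))\<^sup>2 + 2 * (L2_norm \<Omega> dp)\<^sup>2))"
    unfolding energy_def L2_norm_squared using gg en
    by simp
  finally show ?thesis unfolding DG_def dp_def ds_def .
qed

text \<open>Testing the pressure equation with the pressure shows that the velocity is orthogonal to
  \<open>grad p\<close>. Hence its squared norm sees only the part \<open>\<gamma> \<phi> grad \<mu>\<close>, and this is the
  convective term of the phase equation tested with \<open>\<mu>\<close>.\<close>

lemma velocity_dissipation:
  fixes p \<mu> \<phi> :: "nat \<Rightarrow> real^'d \<Rightarrow> real" and \<gamma> :: real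
  assumes fe: "p m \<in> fe_space r' \<Omega> \<T>" "\<mu> m \<in> fe_space r \<Omega> \<T>" "\<phi> (m - 1) \<in> fe_space r \<Omega> \<T>"
    and \<gamma>: "\<gamma> > 0"
    and pressure:
      "L2_inner \<Omega> (\<lambda>x. grad (p m) x + (\<gamma> * \<phi> (m - 1) x) *\<^sub>R grad (\<mu> m) x) (grad (p m)) = 0"
  shows "L2_inner \<Omega>
      (\<lambda>x. \<phi> (m - 1) x *\<^sub>R (grad (p m) x + (\<gamma> * \<phi> (m - 1) x) *\<^sub>R grad (\<mu> m) x)) (grad (\<mu> m))
    = 1/\<gamma> * (L2_norm \<Omega> (velocity \<gamma> p \<mu> \<phi> m))\<^sup>2"
proof -
  let ?M = "lebesgue_on \<Omega>" and ?b = "\<phi> (m - 1)"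
  define G where "G = (\<lambda>x. grad (p m) x + (\<gamma> * ?b x) *\<^sub>R grad (\<mu> m) x)"
  note int = ess_bounded_integrable[OF finite_measure_domain]
  have eb: "ess_bounded ?M ?b" "ess_bounded ?M (grad (p m))" "ess_bounded ?M (grad (\<mu> m))"
    using fe by (auto intro: ess_bounded_fe_space ess_bounded_grad_fe_space)
  have eG: "ess_bounded ?M G" unfolding G_def by (intro ess_bounded_intros eb)
  have i: "integrable ?M (\<lambda>x. G x \<bullet> grad (p m) x)"
    "integrable ?M (\<lambda>x. (?b x *\<^sub>R G x) \<bullet> grad (\<mu> m) x)"
    by (intro int ess_bounded_intros eb eG)+
  have "(L2_norm \<Omega> (velocity \<gamma> p \<mu> \<phi> m))\<^sup>2
      = (LINT x|?M. G x \<bullet> grad (p m) x + \<gamma> * ((?b x *\<^sub>R G x) \<bullet> grad (\<mu> m) x))"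
    unfolding L2_norm_squared velocity_def G_def
    by (intro Bochner_Integration.integral_cong) (auto simp: algebra_simps)
  also have "\<dots> = \<gamma> * L2_inner \<Omega> (\<lambda>x. ?b x *\<^sub>R G x) (grad (\<mu> m))"
    using i pressure[folded G_def] unfolding L2_inner_def by simp
  finally show ?thesis using \<gamma> unfolding G_def by simp
qed

lemma fully_discrete_solution_fe_space:
  assumes "fully_discrete_solution \<epsilon> \<gamma> \<tau> M \<Omega> V W \<phi>\<^sub>0 p \<mu> \<phi>" "\<phi>\<^sub>0 \<in> V" "m \<le> M"
  shows "\<phi> m \<in> V"
  using assms unfolding fully_discrete_solution_def by (cases "m = 0") auto

text \<open>The chemical potential pairs with \<open>d\<^sub>t \<phi>\<close> both in the phase equation tested with \<open>\<mu>\<close>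
  and in the potential equation tested with \<open>d\<^sub>t \<phi>\<close>; eliminating this pairing relates the
  dissipation to the energy increment.\<close>

lemma one_step_energy_balance:
  assumes scheme: "fully_discrete_solution \<epsilon> \<gamma> \<tau> M \<Omega> (fe_space r \<Omega> \<T>) (fe_space r' \<Omega> \<T>) \<phi>\<^sub>0 p \<mu> \<phi>"
    and init: "\<phi>\<^sub>0 \<in> fe_space r \<Omega> \<T>"
    and pos: "\<epsilon> > 0" "\<gamma> > 0" "\<tau> > 0"
    and m: "1 \<le> m" "m \<le> M"
  shows "energy \<epsilon> \<Omega> (\<phi> m) + \<tau> * (
          \<epsilon> * (L2_norm \<Omega> (grad (\<mu> m)))\<^sup>2
          + 1/\<gamma> * (L2_norm \<Omega> (velocity \<gamma> p \<mu> \<phi> m))\<^sup>2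
          + \<tau> / (4 * \<epsilon>) *
              (2 * \<epsilon>\<^sup>2 * (L2_norm \<Omega> (d\<^sub>t \<tau> (\<lambda>k. grad (\<phi> k)) m))\<^sup>2
               + (L2_norm \<Omega> (d\<^sub>t \<tau> (\<lambda>k x. (\<phi> k x)\<^sup>2) m))\<^sup>2
               + 2 * (L2_norm \<Omega> (\<lambda>x. \<phi> m x * d\<^sub>t \<tau> \<phi> m x))\<^sup>2
               + 2 * (L2_norm \<Omega> (d\<^sub>t \<tau> \<phi> m))\<^sup>2))
      = energy \<epsilon> \<Omega> (\<phi> (m - 1))"
    (is "?E + \<tau> * (?diss + ?vel + ?num) = ?E'")
proof -
  have \<phi>: "\<phi> m \<in> fe_space r \<Omega> \<T>" "\<phi> (m - 1) \<in> fe_space r \<Omega> \<T>"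
    using fully_discrete_solution_fe_space[OF scheme init] m by auto
  have fe: "p m \<in> fe_space r' \<Omega> \<T>" "\<mu> m \<in> fe_space r \<Omega> \<T>"
    using scheme m unfolding fully_discrete_solution_def by auto
  have pressure:
    "L2_inner \<Omega> (\<lambda>x. grad (p m) x + (\<gamma> * \<phi> (m - 1) x) *\<^sub>R grad (\<mu> m) x) (grad (p m)) = 0"
    and phase: "L2_inner \<Omega> (d\<^sub>t \<tau> \<phi> m) (\<mu> m) + \<epsilon> * L2_inner \<Omega> (grad (\<mu> m)) (grad (\<mu> m))
      + L2_inner \<Omega>
          (\<lambda>x. \<phi> (m - 1) x *\<^sub>R (grad (p m) x + (\<gamma> * \<phi> (m - 1) x) *\<^sub>R grad (\<mu> m) x))
          (grad (\<mu> m)) = 0"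
    and potential: "L2_inner \<Omega> (\<mu> m) (d\<^sub>t \<tau> \<phi> m)
      - \<epsilon> * L2_inner \<Omega> (grad (\<phi> m)) (grad (d\<^sub>t \<tau> \<phi> m))
      - 1/\<epsilon> * L2_inner \<Omega> (\<lambda>x. (\<phi> m x)^3 - \<phi> (m - 1) x) (d\<^sub>t \<tau> \<phi> m) = 0"
    using scheme m fe d\<^sub>t_fe_space[of \<phi>, OF \<phi>] unfolding fully_discrete_solution_def by auto
  have "L2_inner \<Omega> (\<mu> m) (d\<^sub>t \<tau> \<phi> m) = L2_inner \<Omega> (d\<^sub>t \<tau> \<phi> m) (\<mu> m)"
    unfolding L2_inner_def by (simp add: mult.commute)
  moreover have "?diss = \<epsilon> * L2_inner \<Omega> (grad (\<mu> m)) (grad (\<mu> m))"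
    unfolding L2_norm_squared L2_inner_def ..
  ultimately have "?diss + ?vel = - (\<epsilon> * L2_inner \<Omega> (grad (\<phi> m)) (grad (d\<^sub>t \<tau> \<phi> m))
      + 1/\<epsilon> * L2_inner \<Omega> (\<lambda>x. (\<phi> m x)^3 - \<phi> (m - 1) x) (d\<^sub>t \<tau> \<phi> m))"
    using phase potential velocity_dissipation[of p m r' \<mu> r \<phi> \<gamma>, OF fe \<phi>(2) pos(2) pressure]
    by linarith
  then have "\<tau> * (?diss + ?vel) = - (\<tau> * (\<epsilon> * L2_inner \<Omega> (grad (\<phi> m)) (grad (d\<^sub>t \<tau> \<phi> m))
      + 1/\<epsilon> * L2_inner \<Omega> (\<lambda>x. (\<phi> m x)^3 - \<phi> (m - 1) x) (d\<^sub>t \<tau> \<phi> m)))"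
    by (simp only: mult_minus_right)
  also have "\<dots> = - (?E - ?E' + \<tau> * ?num)"
    unfolding energy_increment[of \<phi>, OF \<phi> pos(1) pos(3)] ..
  finally show ?thesis by (simp add: distrib_left)
qed

end

section \<open>The discrete energy law\<close>

theorem lemma3p5:
  fixes \<Omega> :: "(real^'d) set" and \<T> :: "(real^'d) set set"
    and \<epsilon> \<gamma> T \<sigma> \<tau> :: real and M r r' l :: nat
    and \<phi>\<^sub>0 :: "real^'d \<Rightarrow> real"
    and p \<mu> \<phi> :: "nat \<Rightarrow> real^'d \<Rightarrow> real"
  assumes dim: "CARD('d) = 2 \<or> CARD('d) = 3"
    and domain: "bounded_polyhedral_domain \<Omega>"
    and params: "\<gamma> > 0" "T > 0" "0 < \<epsilon>" "\<epsilon> < 1"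
    and time: "M \<ge> 1" "\<tau> = T / real M"
    and mesh: "triangulation_of \<Omega> \<T>" "mesh_size \<T> \<in> {0<..<1}"
      "\<sigma> > 0" "quasi_uniform \<sigma> \<T>"
    and degrees: "r \<ge> 1" "r' \<ge> 1"
    and init: "\<phi>\<^sub>0 \<in> fe_space r \<Omega> \<T>"
    and scheme: "fully_discrete_solution \<epsilon> \<gamma> \<tau> M \<Omega> (fe_space r \<Omega> \<T>) (fe_space r' \<Omega> \<T>) \<phi>\<^sub>0 p \<mu> \<phi>"
    and l: "l \<le> M"
  shows "energy \<epsilon> \<Omega> (\<phi> l)
      + \<tau> * (\<Sum>m=1..l.
          \<epsilon> * (L2_norm \<Omega> (grad (\<mu> m)))\<^sup>2
          + 1/\<gamma> * (L2_norm \<Omega> (velocity \<gamma> p \<mu> \<phi> m))\<^sup>2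
          + \<tau> / (4 * \<epsilon>) *
              (2 * \<epsilon>\<^sup>2 * (L2_norm \<Omega> (d\<^sub>t \<tau> (\<lambda>k. grad (\<phi> k)) m))\<^sup>2
               + (L2_norm \<Omega> (d\<^sub>t \<tau> (\<lambda>k x. (\<phi> k x)\<^sup>2) m))\<^sup>2
               + 2 * (L2_norm \<Omega> (\<lambda>x. \<phi> m x * d\<^sub>t \<tau> \<phi> m x))\<^sup>2
               + 2 * (L2_norm \<Omega> (d\<^sub>t \<tau> \<phi> m))\<^sup>2))
      = energy \<epsilon> \<Omega> (\<phi> 0)"
proof -
  interpret polyhedral_mesh \<Omega> \<T> using domain mesh(1) by unfold_locales
  have \<tau>: "\<tau> > 0" using params time by simp
  show ?thesis
    using l
  proof (induction l)
    case 0
    then show ?case by simp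
  next
    case (Suc n)
    show ?case
      using Suc one_step_energy_balance[OF scheme init params(3,1) \<tau>, of "Suc n"]
      by (simp add: distrib_left)
  qed
qed

end
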